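(* Let $\Gamma$ be a good pointclass. If every set in $\Gamma \cap [\mathbb{N}]^\infty$ has the Ramsey property, then there is no MAD family in $\Gamma \cap [\mathbb{N}]^\infty$, i.e. no MAD family $\mathcal{A} \subseteq [\mathbb{N}]^\infty$ with $\mathcal{A} \in \Gamma$.
   Context: $[\mathbb{N}]^\infty$ denotes the Polish space of infinite subsets of $\mathbb{N}$ (topologized as a subspace of $2^{\mathbb{N}}$), and for $w \in [\mathbb{N}]^\infty$, $[w]^\infty$ denotes the set of infinite subsets of $w$. A set $X \subseteq [\mathbb{N}]^\infty$ has the Ramsey property if there is $w \in [\mathbb{N}]^\infty$ with $[w]^\infty \subseteq X$ or $[w]^\infty \cap X = \emptyset$. A set $\mathcal{A} \subseteq [\mathbb{N}]^\infty$ is a MAD family if $\mathcal{A}$ is infinite, $A \cap B$ is finite for all distinct $A, B \in \mathcal{A}$, and for every $C \in [\mathbb{N}]^\infty$ there is $A \in \mathcal{A}$ with $C \cap A$ infinite. A boldface pointclass is a collection of subsets of Polish spaces which is closed under continuous preimages and contains all clopen sets; a pointclass is called good if it is a boldface pointclass that is moreover closed under intersections and under continuous images. *)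

theory Defs
  imports "HOL-Analysis.Analysis"
begin

definition Polish_space :: "'a topology \<Rightarrow> bool" where
  "Polish_space X \<longleftrightarrow> completely_metrizable_space X \<and> separable_space X"

text \<open>
  A pointclass is a collection of subsets of Polish spaces. It is represented as a function
  that sends a Polish space \<open>X\<close> to the collection of those subsets of \<open>X\<close> which belong to the
  pointclass. Values at topologies that are not Polish are irrelevant.

  The points of the spaces come from one fixed type \<open>'a\<close>. For \<open>'a = nat set\<close> this is no
  restriction: by \<open>Polish_space_copy\<close> below, every Polish space, whatever the type of its
  points, is homeomorphic to one carried by a subset of type \<open>nat set\<close>, and a boldface
  pointclass is invariant under homeomorphisms, so that it is determined by its values there.

  Closure under intersections means binary intersections, and continuous maps are total on
  their Polish domain.
\<close>

definition boldface_pointclass :: "('a topology \<Rightarrow> 'a set set) \<Rightarrow> bool" where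
  "boldface_pointclass \<Gamma> \<longleftrightarrow>
     (\<forall>X. Polish_space X \<longrightarrow> (\<forall>A\<in>\<Gamma> X. A \<subseteq> topspace X)) \<and>
     (\<forall>X. Polish_space X \<longrightarrow> (\<forall>A. openin X A \<and> closedin X A \<longrightarrow> A \<in> \<Gamma> X)) \<and>
     (\<forall>X Y f. Polish_space X \<and> Polish_space Y \<and> continuous_map X Y f \<longrightarrow>
        (\<forall>A\<in>\<Gamma> Y. {x \<in> topspace X. f x \<in> A} \<in> \<Gamma> X))"

definition good_pointclass :: "('a topology \<Rightarrow> 'a set set) \<Rightarrow> bool" where
  "good_pointclass \<Gamma> \<longleftrightarrow>
     boldface_pointclass \<Gamma> \<and>
     (\<forall>X. Polish_space X \<longrightarrow> (\<forall>A\<in>\<Gamma> X. \<forall>B\<in>\<Gamma> X. A \<inter> B \<in> \<Gamma> X)) \<and>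
     (\<forall>X Y f. Polish_space X \<and> Polish_space Y \<and> continuous_map X Y f \<longrightarrow>
        (\<forall>A\<in>\<Gamma> X. f ` A \<in> \<Gamma> Y))"

definition infinite_subsets :: "nat set \<Rightarrow> nat set set" where
  "infinite_subsets w = {A. A \<subseteq> w \<and> infinite A}"

text \<open>The topology of \<open>2\<^sup>\<nat>\<close>, transported to sets of naturals along characteristic functions.\<close>

definition cantor_topology :: "nat set topology" where
  "cantor_topology =
     pullback_topology UNIV (\<lambda>A n. n \<in> A) (product_topology (\<lambda>_. discrete_topology UNIV) UNIV)"

definition infinite_subsets_space :: "nat set topology" where
  "infinite_subsets_space = subtopology cantor_topology (infinite_subsets UNIV)"

definition Ramsey_property :: "nat set set \<Rightarrow> bool" where
  "Ramsey_property X \<longleftrightarrow>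
     (\<exists>w \<in> infinite_subsets UNIV. infinite_subsets w \<subseteq> X \<or> infinite_subsets w \<inter> X = {})"

definition MAD_family :: "nat set set \<Rightarrow> bool" where
  "MAD_family \<A> \<longleftrightarrow>
     \<A> \<subseteq> infinite_subsets UNIV \<and> infinite \<A> \<and>
     (\<forall>A\<in>\<A>. \<forall>B\<in>\<A>. A \<noteq> B \<longrightarrow> finite (A \<inter> B)) \<and>
     (\<forall>C\<in>infinite_subsets UNIV. \<exists>A\<in>\<A>. infinite (C \<inter> A))"

lemma Polish_space_homeomorphic:
  assumes "X homeomorphic_space Y" "Polish_space X"
  shows "Polish_space Y"
  using assms homeomorphic_completely_metrizable_space homeomorphic_separable_space
  unfolding Polish_space_def by blast

lemma homeomorphic_maps_pullback:
  assumes "inj_on e (topspace X)"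
  shows "homeomorphic_maps X
    (pullback_topology (e ` topspace X) (inv_into (topspace X) e) X) e (inv_into (topspace X) e)"
proof -
  let ?g = "inv_into (topspace X) e"
  let ?Y = "pullback_topology (e ` topspace X) ?g X"
  have "continuous_map X ?Y e"
  proof (rule continuous_map_pullback')
    show "continuous_map X X (?g \<circ> e)"
      by (rule continuous_map_eq[of _ _ id]) (auto simp: assms)
  qed auto
  moreover have "continuous_map ?Y X (id \<circ> ?g)"
    by (rule continuous_map_pullback) auto
  ultimately show ?thesis
    unfolding homeomorphic_maps_def
    by (auto simp: topspace_pullback_topology assms f_inv_into_f)
qed

lemma Polish_space_inj_nat_set:
  assumes "Polish_space X"
  shows "\<exists>e :: 'a \<Rightarrow> nat set. inj_on e (topspace (X :: 'a topology))"
proof -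
  obtain M d where M: "Metric_space M d" and X: "X = Metric_space.mtopology M d"
    using assms unfolding Polish_space_def completely_metrizable_space_def by blast
  interpret Metric_space M d by fact
  obtain D where D: "countable D" "D \<subseteq> M" "mtopology closure_of D = M"
    using assms unfolding Polish_space_def separable_space_def X by auto
  define e where "e x = to_nat ` {(i, j :: nat). d x (from_nat_into D i) < inverse (Suc j)}" for x
  have "x = y" if xy: "x \<in> M" "y \<in> M" "e x = e y" for x y
  proof (rule ccontr)
    assume "x \<noteq> y"
    then have "d x y > 0" using xy by simp
    then obtain j where j: "inverse (real (Suc j)) < d x y / 2"
      using reals_Archimedean[of "d x y / 2"] by auto
    have "x \<in> mtopology closure_of D" using D(3) xy(1) by simp
    then have *: "\<exists>z\<in>D. z \<in> mball x r" if "r > 0" for r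
      using that unfolding metric_closure_of by blast
    have "inverse (real (Suc j)) > 0" by simp
    from *[OF this] obtain z where z: "z \<in> D" "z \<in> mball x (inverse (real (Suc j)))" by blast
    then have z: "z \<in> D" "z \<in> M" "d x z < inverse (real (Suc j))"
      unfolding in_mball by blast+
    obtain i where i: "from_nat_into D i = z"
      using z D(1) by (metis from_nat_into_surj)
    have "to_nat (i, j) \<in> e x" using z i by (auto simp: e_def)
    then have "to_nat (i, j) \<in> e y" using xy by simp
    then have "d y z < inverse (real (Suc j))" using i by (auto simp: e_def)
    moreover have "d x y \<le> d x z + d z y" using xy z triangle by blast
    ultimately show False using j z commute[of y z] by linarith
  qed
  then show ?thesis unfolding X by (auto simp: inj_on_def)
qed

text \<open>Type \<open>nat set\<close> carries a copy of every Polish space.\<close>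

lemma Polish_space_copy:
  assumes "Polish_space (X :: 'a topology)"
  shows "\<exists>Y :: nat set topology. Polish_space Y \<and> X homeomorphic_space Y"
proof -
  obtain e :: "'a \<Rightarrow> nat set" where "inj_on e (topspace X)"
    using Polish_space_inj_nat_set[OF assms] by blast
  then show ?thesis
    using homeomorphic_maps_pullback[of e X] Polish_space_homeomorphic assms
    unfolding homeomorphic_space_def by blast
qed

lemma topspace_infinite_subsets_space [simp]:
  "topspace infinite_subsets_space = infinite_subsets UNIV"
  by (simp add: infinite_subsets_space_def cantor_topology_def topspace_pullback_topology)

lemma openin_cantor_topology_mem: "openin cantor_topology {A. n \<in> A}"
proof -
  let ?P = "product_topology (\<lambda>_::nat. discrete_topology (UNIV::bool set)) UNIV"
  have "openin ?P {f \<in> topspace ?P. f n \<in> {True}}"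
    by (rule openin_continuous_map_preimage[where Y = "discrete_topology UNIV"])
      (auto intro: continuous_map_product_projection)
  then show ?thesis
    unfolding cantor_topology_def openin_pullback_topology
    by (intro exI[of _ "{f \<in> topspace ?P. f n \<in> {True}}"]) auto
qed

lemma openin_cantor_topology_finite:
  assumes "openin cantor_topology U" "x \<in> U"
  obtains F where "finite F" "\<And>A. A \<inter> F = x \<inter> F \<Longrightarrow> A \<in> U"
proof -
  obtain V where V: "openin (product_topology (\<lambda>_::nat. discrete_topology (UNIV::bool set)) UNIV) V"
    and U: "U = (\<lambda>A n. n \<in> A) -` V"
    using assms(1) unfolding cantor_topology_def openin_pullback_topology by auto
  have "(\<lambda>n. n \<in> x) \<in> V" using assms(2) U by auto
  then obtain W where W: "finite {i. W i \<noteq> UNIV}" "(\<lambda>n. n \<in> x) \<in> Pi\<^sub>E UNIV W" "Pi\<^sub>E UNIV W \<subseteq> V"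
    using V unfolding openin_product_topology_alt by fastforce
  show thesis
  proof (rule that[OF W(1)])
    fix A assume A: "A \<inter> {i. W i \<noteq> UNIV} = x \<inter> {i. W i \<noteq> UNIV}"
    have "(n \<in> A) \<in> W n" for n
    proof (cases "W n = UNIV")
      case False
      then have "n \<in> A \<longleftrightarrow> n \<in> x" using A by blast
      then show ?thesis using W(2) by (auto simp: PiE_iff)
    qed simp
    then show "A \<in> U" using W(3) U by (auto simp: PiE_iff)
  qed
qed

lemma completely_metrizable_cantor_topology: "completely_metrizable_space cantor_topology"
proof -
  let ?P = "product_topology (\<lambda>_::nat. discrete_topology (UNIV::bool set)) UNIV"
  let ?c = "\<lambda>A n::nat. n \<in> A"
  have "continuous_map cantor_topology ?P (id \<circ> ?c)"
    unfolding cantor_topology_def by (rule continuous_map_pullback) auto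
  moreover have "continuous_map ?P cantor_topology Collect"
    unfolding cantor_topology_def
    by (rule continuous_map_pullback') (auto simp: comp_def)
  ultimately have "homeomorphic_maps ?P cantor_topology Collect ?c"
    unfolding homeomorphic_maps_def by auto
  moreover have "completely_metrizable_space ?P"
    by (simp add: completely_metrizable_space_product_topology completely_metrizable_space_discrete_topology)
  ultimately show ?thesis
    using homeomorphic_completely_metrizable_space homeomorphic_space_def by blast
qed

lemma Polish_infinite_subsets_space: "Polish_space infinite_subsets_space"
  unfolding Polish_space_def
proof
  have "openin cantor_topology {A. \<exists>m\<ge>n. m \<in> A}" for n
  proof -
    have "{A. \<exists>m\<ge>n. m \<in> A} = (\<Union>m\<in>{n..}. {A. m \<in> A})" by auto
    then show ?thesis using openin_cantor_topology_mem by auto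
  qed
  then have "gdelta_in cantor_topology (\<Inter>n. {A. \<exists>m\<ge>n. m \<in> A})"
    by (intro gdelta_in_Inter) (auto intro: open_imp_gdelta_in)
  moreover have "(\<Inter>n. {A. \<exists>m\<ge>n. m \<in> A}) = infinite_subsets UNIV"
    by (auto simp: infinite_subsets_def infinite_nat_iff_unbounded_le)
  ultimately show "completely_metrizable_space infinite_subsets_space"
    unfolding infinite_subsets_space_def
    using completely_metrizable_space_gdelta_in completely_metrizable_cantor_topology by auto
next
  let ?C = "{A :: nat set. finite (- A)}"
  have inf: "infinite A" if "finite (- A)" for A :: "nat set"
    using that by (metis Compl_partition finite_Un infinite_UNIV_nat)
  have "?C \<subseteq> uminus ` {A. finite A}"
  proof
    fix A :: "nat set" assume "A \<in> ?C"
    then show "A \<in> uminus ` {A. finite A}" by (intro image_eqI[of _ _ "- A"]) simp_all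
  qed
  moreover have "countable (uminus ` {A :: nat set. finite A})"
    by (intro countable_image countable_Collect_finite)
  ultimately have "countable ?C" by (rule countable_subset)
  moreover have "infinite_subsets_space closure_of ?C = infinite_subsets UNIV"
  proof -
    have "\<exists>y\<in>?C. y \<in> T" if T: "openin infinite_subsets_space T" "x \<in> T" for x T
    proof -
      obtain U where U: "openin cantor_topology U" "T = U \<inter> infinite_subsets UNIV"
        using T unfolding infinite_subsets_space_def openin_subtopology by auto
      obtain F where F: "finite F" "\<And>A. A \<inter> F = x \<inter> F \<Longrightarrow> A \<in> U"
        using openin_cantor_topology_finite[OF U(1)] T U by blast
      have "finite (- (x \<union> - F))" using F(1) by simp
      moreover have "x \<union> - F \<in> U" by (rule F(2)) auto
      moreover have "infinite (x \<union> - F)" using calculation(1) by (rule inf)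
      ultimately have "x \<union> - F \<in> ?C" "x \<union> - F \<in> T"
        unfolding U(2) infinite_subsets_def by blast+
      then show ?thesis by (rule bexI[rotated])
    qed
    then show ?thesis unfolding closure_of_def topspace_infinite_subsets_space by blast
  qed
  moreover have "?C \<subseteq> infinite_subsets UNIV"
    unfolding infinite_subsets_def using inf by blast
  ultimately show "separable_space infinite_subsets_space"
    unfolding separable_space_def topspace_infinite_subsets_space by blast
qed

end

theory Submission
  imports Defs
begin

text \<open>
  Let \<open>A 0, A 1, \<dots>\<close> be distinct members of the family, let \<open>a i j\<close> be the \<open>j\<close>-th element of \<open>A i\<close>,
  and for \<open>z = {z 0 < z 1 < \<dots>}\<close> put \<open>C z = {a (z (2k)) (z (2k+1)) | k}\<close>. The set \<open>X\<close> of those \<open>z\<close>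
  for which some member of the family contains \<open>C z\<close> is a projection of a set in the pointclass,
  hence Ramsey, and by maximality it meets every \<open>[w]\<^sup>\<infinity>\<close>; so \<open>[w]\<^sup>\<infinity> \<subseteq> X\<close> for some \<open>w\<close>. By almost
  disjointness the member containing \<open>C z\<close> is unique and does not change when an initial segment
  of even length of \<open>z\<close> is replaced by another one. Replacing it by a pair \<open>m < n\<close> from \<open>w\<close> shows
  that the member \<open>B\<close> containing \<open>C w\<close> contains every \<open>a m n\<close> with \<open>m < n\<close> in \<open>w\<close>. So \<open>B\<close> meets \<open>A m\<close>
  in an infinite set, that is, \<open>B = A m\<close>, for every \<open>m\<close> in \<open>w\<close>, a contradiction.
\<close>

subsection \<open>Subspaces of the Cantor space\<close>

lemma topspace_cantor_topology [simp]: "topspace cantor_topology = UNIV"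
  by (simp add: cantor_topology_def topspace_pullback_topology)

lemma continuous_map_cantor_topology_mem:
  "continuous_map cantor_topology (discrete_topology UNIV) (\<lambda>A. n \<in> A)"
proof -
  let ?P = "product_topology (\<lambda>_::nat. discrete_topology (UNIV::bool set)) UNIV"
  have "continuous_map ?P (discrete_topology UNIV) (\<lambda>f. f n)"
    by (auto intro: continuous_map_product_projection)
  then have "continuous_map cantor_topology (discrete_topology UNIV) ((\<lambda>f. f n) \<circ> (\<lambda>A n. n \<in> A))"
    unfolding cantor_topology_def by (rule continuous_map_pullback)
  then show ?thesis by (simp add: comp_def)
qed

lemma continuous_map_cantor_topology_vimage:
  "continuous_map cantor_topology cantor_topology (\<lambda>A. h -` A)"
  by (subst (2) cantor_topology_def, rule continuous_map_pullback')
    (simp_all add: comp_def continuous_map_componentwise_UNIV continuous_map_cantor_topology_mem)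

lemma openin_cantor_topology_finitely_determined:
  assumes "finite F" and P: "\<And>A B. A \<inter> F = B \<inter> F \<Longrightarrow> P A \<Longrightarrow> P B"
  shows "openin cantor_topology {A. P A}"
proof -
  have mem: "openin cantor_topology {B. n \<in> B \<longleftrightarrow> b}" for n b
    using openin_continuous_map_preimage[OF continuous_map_cantor_topology_mem, of "{b}" n]
    by simp
  have "openin cantor_topology {B. B \<inter> F = A \<inter> F}" for A
  proof -
    have "openin cantor_topology (\<Inter>n\<in>F. {B. n \<in> B \<longleftrightarrow> n \<in> A})" if "F \<noteq> {}"
      using assms(1) that by (intro openin_INT2) (auto simp: mem)
    moreover have "{B. B \<inter> F = A \<inter> F} = (\<Inter>n\<in>F. {B. n \<in> B \<longleftrightarrow> n \<in> A})"
      by auto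
    ultimately show ?thesis
      using openin_topspace[of cantor_topology] by (cases "F = {}") simp_all
  qed
  then have "openin cantor_topology (\<Union>A\<in>Collect P. {B. B \<inter> F = A \<inter> F})"
    by blast
  moreover have "(\<Union>A\<in>Collect P. {B. B \<inter> F = A \<inter> F}) = {A. P A}"
    using P by (intro set_eqI) (simp, metis)
  ultimately show ?thesis by simp
qed

text \<open>Choosing a point of \<open>Y\<close> for each trace on a finite set that
  \<open>Y\<close> realizes gives a dense set, and there are only countably many finite sets and
  traces.\<close>

lemma separable_space_subtopology_cantor: "separable_space (subtopology cantor_topology Y)"
proof -
  define p where "p F s = (SOME A. A \<in> Y \<and> A \<inter> F = s)" for F s :: "nat set"
  \<comment> \<open>Intersecting with \<open>Y\<close> discards the arbitrary values that
    \<open>p F s\<close> takes when no point of \<open>Y\<close> has trace \<open>s\<close> on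
    \<open>F\<close>.\<close>
  define D where "D = (\<lambda>(F, s). p F s) ` (Collect finite \<times> Collect finite) \<inter> Y"
  have "countable D"
    unfolding D_def by (intro countable_Int1 countable_image countable_SIGMA countable_Collect_finite)
  moreover have "subtopology cantor_topology Y closure_of D = Y"
  proof -
    have "\<exists>y\<in>D. y \<in> T" if T: "openin (subtopology cantor_topology Y) T" "x \<in> T" for x T
    proof -
      obtain U where U: "openin cantor_topology U" "T = U \<inter> Y"
        using T unfolding openin_subtopology by auto
      obtain F where F: "finite F" "\<And>A. A \<inter> F = x \<inter> F \<Longrightarrow> A \<in> U"
        using openin_cantor_topology_finite[OF U(1)] T U by blast
      have "p F (x \<inter> F) \<in> Y \<and> p F (x \<inter> F) \<inter> F = x \<inter> F"
        unfolding p_def by (rule someI[of _ x]) (use T U in auto)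
      then show ?thesis
        using F U unfolding D_def by (intro bexI[of _ "p F (x \<inter> F)"]) force+
    qed
    then show ?thesis unfolding closure_of_def by auto
  qed
  ultimately show ?thesis
    unfolding separable_space_def by (intro exI[of _ D]) (auto simp: D_def)
qed

lemma Polish_space_gdelta_cantor:
  "gdelta_in cantor_topology Y \<Longrightarrow> Polish_space (subtopology cantor_topology Y)"
  unfolding Polish_space_def
  by (simp add: completely_metrizable_space_gdelta_in completely_metrizable_cantor_topology
      separable_space_subtopology_cantor)

lemma gdelta_in_countable_Collect_all:
  assumes "\<And>i :: 'i :: countable. gdelta_in cantor_topology {A. P i A}"
  shows "gdelta_in cantor_topology {A. \<forall>i. P i A}"
proof -
  have "gdelta_in cantor_topology (\<Inter>(range (\<lambda>i. {A. P i A})))"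
    using assms by (intro gdelta_in_Inter) auto
  moreover have "\<Inter>(range (\<lambda>i. {A. P i A})) = {A. \<forall>i. P i A}" by auto
  ultimately show ?thesis by simp
qed

lemma gdelta_in_infinite_vimage:
  fixes h :: "nat \<Rightarrow> nat"
  shows "gdelta_in cantor_topology {B. infinite (h -` B)}"
proof -
  have "openin cantor_topology {B. \<exists>m\<ge>n. h m \<in> B}" for n
  proof -
    have "openin cantor_topology (\<Union>m\<in>{n..}. {B. h m \<in> B})"
      using openin_cantor_topology_mem by auto
    moreover have "(\<Union>m\<in>{n..}. {B. h m \<in> B}) = {B. \<exists>m\<ge>n. h m \<in> B}" by auto
    ultimately show ?thesis by simp
  qed
  then have "gdelta_in cantor_topology {B. \<forall>n. \<exists>m\<ge>n. h m \<in> B}"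
    by (intro gdelta_in_countable_Collect_all open_imp_gdelta_in)
  then show ?thesis by (simp add: infinite_nat_iff_unbounded_le)
qed

subsection \<open>Blocks of two consecutive elements\<close>

text \<open>
  For \<open>z = {z 0 < z 1 < \<dots>}\<close> this says that \<open>m = z (2k)\<close> and \<open>n = z (2k+1)\<close> for some \<open>k\<close>. The phrasing
  makes it visible that only \<open>z \<inter> {..n}\<close> matters.
\<close>

definition block :: "nat set \<Rightarrow> nat \<Rightarrow> nat \<Rightarrow> bool" where
  "block z m n \<longleftrightarrow>
     m \<in> z \<and> n \<in> z \<and> m < n \<and> z \<inter> {m<..<n} = {} \<and> even (card (z \<inter> {..<m}))"

text \<open>Dependence on a finite part of \<open>z\<close> alone is what makes the block condition
  open in the Cantor topology.\<close>

lemma block_cong: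
  assumes "z \<inter> {..n} = z' \<inter> {..n}"
  shows "block z m n \<longleftrightarrow> block z' m n"
proof -
  have mem: "k \<in> z \<longleftrightarrow> k \<in> z'" if "k \<le> n" for k
    using assms that by blast
  show ?thesis
  proof (cases "m < n")
    case True
    then have "z \<inter> {..<m} = z' \<inter> {..<m}" "z \<inter> {m<..<n} = z' \<inter> {m<..<n}"
      using mem by auto
    then show ?thesis unfolding block_def using mem[of m] mem[of n] True by auto
  qed (simp add: block_def)
qed

text \<open>Exactly \<open>i\<close> elements lie below \<open>u i\<close>, so the parity clause of
  \<open>block\<close> concerns the index, and the empty gap forces consecutive indices.\<close>

lemma block_range:
  assumes "strict_mono u"
  shows "block (range u) m n \<longleftrightarrow> (\<exists>k. m = u (2 * k) \<and> n = u (Suc (2 * k)))"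
proof -
  have less: "u i < u j \<longleftrightarrow> i < j" for i j
    using assms by (simp add: strict_mono_less)
  have card: "card (range u \<inter> {..<u i}) = i" for i
  proof -
    have "range u \<inter> {..<u i} = u ` {..<i}" using less by auto
    moreover have "inj_on u {..<i}"
      by (simp add: inj_on_def strict_mono_eq[OF assms])
    ultimately show ?thesis by (simp add: card_image)
  qed
  have gap: "j = Suc i" if "i < j" "range u \<inter> {u i<..<u j} = {}" for i j
  proof (rule ccontr)
    assume "j \<noteq> Suc i"
    then have "u (Suc i) \<in> range u \<inter> {u i<..<u j}"
      using that(1) by (simp add: less)
    then show False using that(2) by blast
  qed
  show ?thesis
  proof
    assume "block (range u) m n"
    then obtain i j where ij: "m = u i" "n = u j" "i < j" "range u \<inter> {u i<..<u j} = {}" "even i"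
      unfolding block_def using card less by auto
    then show "\<exists>k. m = u (2 * k) \<and> n = u (Suc (2 * k))" using gap[OF ij(3,4)] by (auto elim!: evenE)
  next
    assume "\<exists>k. m = u (2 * k) \<and> n = u (Suc (2 * k))"
    then obtain k where "m = u (2 * k)" "n = u (Suc (2 * k))" by blast
    moreover have "range u \<inter> {u (2 * k)<..<u (Suc (2 * k))} = {}"
      by (auto simp: less)
    ultimately show "block (range u) m n"
      unfolding block_def by (simp add: card less)
  qed
qed

lemma infinite_eq_range_strict_mono:
  assumes "infinite (z :: nat set)"
  obtains u :: "nat \<Rightarrow> nat" where "strict_mono u" "z = range u"
  using that[of "enumerate z"] assms by (simp add: range_enumerate strict_mono_enumerate)

lemma infinite_range_strict_mono: "strict_mono (v :: nat \<Rightarrow> nat) \<Longrightarrow> infinite (range v)"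
  by (simp add: range_inj_infinite strict_mono_imp_inj_on)

text \<open>The values are unbounded, because the one at \<open>k\<close> is at least
  \<open>u (Suc (2 * k))\<close>, hence at least \<open>k\<close>.\<close>

lemma infinite_blocks_image:
  fixes a :: "nat \<Rightarrow> nat \<Rightarrow> nat"
  assumes "strict_mono u" "infinite K" "\<And>i j. j \<le> a i j"
  shows "infinite ((\<lambda>k. a (u (2 * k)) (u (Suc (2 * k)))) ` K)"
  unfolding infinite_nat_iff_unbounded_le
proof
  fix m
  obtain k where "k \<in> K" "m \<le> k"
    using assms(2) unfolding infinite_nat_iff_unbounded_le by blast
  moreover have "k \<le> u (Suc (2 * k))"
    using strict_mono_imp_increasing[OF assms(1), of "Suc (2 * k)"] by linarith
  ultimately show "\<exists>n\<ge>m. n \<in> (\<lambda>k. a (u (2 * k)) (u (Suc (2 * k)))) ` K"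
    using assms(3)[of "u (Suc (2 * k))" "u (2 * k)"]
    by (intro exI[of _ "a (u (2 * k)) (u (Suc (2 * k)))"]) auto
qed

subsection \<open>The set of homogeneous sets\<close>

lemma good_pointclass_subset:
  assumes "good_pointclass \<Gamma>" "Polish_space X" "A \<in> \<Gamma> X"
  shows "A \<subseteq> topspace X"
  using assms unfolding good_pointclass_def boldface_pointclass_def by (elim conjE) simp

lemma good_pointclass_preimage:
  assumes "good_pointclass \<Gamma>" "Polish_space X" "Polish_space Y" "continuous_map X Y f" "A \<in> \<Gamma> Y"
  shows "{x \<in> topspace X. f x \<in> A} \<in> \<Gamma> X"
  using assms unfolding good_pointclass_def boldface_pointclass_def by (elim conjE) simp

lemma good_pointclass_image:
  assumes "good_pointclass \<Gamma>" "Polish_space X" "Polish_space Y" "continuous_map X Y f" "A \<in> \<Gamma> X"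
  shows "f ` A \<in> \<Gamma> Y"
  using assms unfolding good_pointclass_def by (elim conjE) simp

text \<open>This is the set \<open>X\<close> of the outline above, with the inclusion of
  \<open>C z\<close> in a member written out through \<open>block\<close>.\<close>

definition homogeneous_sets :: "(nat \<Rightarrow> nat \<Rightarrow> nat) \<Rightarrow> nat set set \<Rightarrow> nat set set" where
  "homogeneous_sets a \<A> =
     {z \<in> infinite_subsets UNIV. \<exists>A\<in>\<A>. \<forall>m n. block z m n \<longrightarrow> a m n \<in> A}"

text \<open>The condition linking \<open>z\<close> to a set that contains \<open>C z\<close> is
  built into the Polish space \<open>?Y\<close>. What remains is to pull the family back along the
  second coordinate and project to the first.\<close>

lemma homogeneous_sets_in_pointclass:
  assumes good: "good_pointclass \<Gamma>" and "\<A> \<in> \<Gamma> infinite_subsets_space"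
  shows "homogeneous_sets a \<A> \<in> \<Gamma> infinite_subsets_space"
proof -
  \<comment> \<open>A set \<open>B\<close> codes the pair of its even part and its odd part.\<close>
  define f g where "f B = (\<lambda>n. 2 * n) -` B" and "g B = (\<lambda>n. Suc (2 * n)) -` B" for B :: "nat set"
  define Q where "Q m n B \<longleftrightarrow> (block (f B) m n \<longrightarrow> a m n \<in> g B)" for m n B
  define Y where "Y = {B. infinite (f B)} \<inter> {B. infinite (g B)} \<inter> {B. \<forall>m n. Q m n B}"
  let ?Y = "subtopology cantor_topology Y"
  have "openin cantor_topology {B. Q m n B}" for m n
  proof (rule openin_cantor_topology_finitely_determined)
    \<comment> \<open>These are the codes of all that \<open>Q m n\<close> inspects: the even part
      up to \<open>n\<close>, and the single point \<open>a m n\<close> of the odd part.\<close>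
    let ?F = "(\<lambda>n. 2 * n) ` {..n} \<union> {Suc (2 * a m n)}"
    show "finite ?F" by simp
    fix A B assume "A \<inter> ?F = B \<inter> ?F"
    then have eq: "i \<in> A \<longleftrightarrow> i \<in> B" if "i \<in> ?F" for i
      using that by blast
    have "f A \<inter> {..n} = f B \<inter> {..n}"
      using eq by (auto simp: f_def)
    then have "block (f A) m n \<longleftrightarrow> block (f B) m n"
      by (rule block_cong)
    moreover have "a m n \<in> g A \<longleftrightarrow> a m n \<in> g B"
      using eq by (auto simp: g_def)
    moreover assume "Q m n A"
    ultimately show "Q m n B" by (simp add: Q_def)
  qed
  then have "gdelta_in cantor_topology Y"
    unfolding Y_def f_def g_def
    by (intro gdelta_in_Int gdelta_in_infinite_vimage gdelta_in_countable_Collect_all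
        open_imp_gdelta_in)
  then have Polish: "Polish_space ?Y"
    by (rule Polish_space_gdelta_cantor)
  have cont: "continuous_map ?Y infinite_subsets_space f" "continuous_map ?Y infinite_subsets_space g"
  proof -
    have vimage: "continuous_map ?Y cantor_topology f" "continuous_map ?Y cantor_topology g"
      unfolding f_def g_def
      by (intro continuous_map_from_subtopology continuous_map_cantor_topology_vimage)+
    have "f ` Y \<subseteq> infinite_subsets UNIV" "g ` Y \<subseteq> infinite_subsets UNIV"
      by (auto simp: Y_def infinite_subsets_def)
    then show "continuous_map ?Y infinite_subsets_space f"
      and "continuous_map ?Y infinite_subsets_space g"
      unfolding infinite_subsets_space_def
      using vimage by (simp_all add: continuous_map_in_subtopology image_subset_iff Pi_iff)
  qed
  have "{B \<in> topspace ?Y. g B \<in> \<A>} \<in> \<Gamma> ?Y"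
    using good_pointclass_preimage[OF good Polish Polish_infinite_subsets_space cont(2) assms(2)] .
  then have "f ` {B \<in> topspace ?Y. g B \<in> \<A>} \<in> \<Gamma> infinite_subsets_space"
    using good_pointclass_image[OF good Polish Polish_infinite_subsets_space cont(1)] by blast
  moreover have "f ` {B \<in> topspace ?Y. g B \<in> \<A>} = homogeneous_sets a \<A>"
  proof (intro equalityI subsetI)
    fix z assume "z \<in> f ` {B \<in> topspace ?Y. g B \<in> \<A>}"
    then show "z \<in> homogeneous_sets a \<A>"
      by (auto simp: homogeneous_sets_def infinite_subsets_def Y_def Q_def)
  next
    fix z assume "z \<in> homogeneous_sets a \<A>"
    then obtain A where A: "infinite z" "A \<in> \<A>" "\<And>m n. block z m n \<Longrightarrow> a m n \<in> A"
      by (auto simp: homogeneous_sets_def infinite_subsets_def)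
    define B where "B = (\<lambda>n. 2 * n) ` z \<union> (\<lambda>n. Suc (2 * n)) ` A"
    have B: "f B = z" "g B = A"
      unfolding f_def g_def B_def by (auto simp: image_iff) presburger+
    have "infinite A"
      using good_pointclass_subset[OF good Polish_infinite_subsets_space assms(2)] A(2)
      by (auto simp: infinite_subsets_def)
    then have "B \<in> Y"
      using A B by (simp add: Y_def Q_def)
    then show "z \<in> f ` {B \<in> topspace ?Y. g B \<in> \<A>}"
      using A(2) B by (intro image_eqI[of _ _ B]) auto
  qed
  ultimately show ?thesis by simp
qed

text \<open>Maximality gives a member that meets \<open>C w\<close> in an infinite set. Keeping only
  the pairs of \<open>w\<close> whose value lies in that member thins \<open>w\<close> to a
  homogeneous set.\<close>

lemma MAD_family_meets_homogeneous_sets: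
  assumes mad: "MAD_family \<A>" and "infinite w" and a: "\<And>i j. j \<le> a i j"
  shows "infinite_subsets w \<inter> homogeneous_sets a \<A> \<noteq> {}"
proof -
  obtain u :: "nat \<Rightarrow> nat" where u: "strict_mono u" "w = range u"
    using infinite_eq_range_strict_mono[OF \<open>infinite w\<close>] .
  let ?c = "\<lambda>k. a (u (2 * k)) (u (Suc (2 * k)))"
  have "infinite (range ?c)"
    using infinite_blocks_image[OF u(1) infinite_UNIV_nat a] .
  then obtain A where A: "A \<in> \<A>" "infinite (range ?c \<inter> A)"
    using mad unfolding MAD_family_def infinite_subsets_def by blast
  have "infinite (?c -` A)"
    using A(2) by (metis finite_imageI image_vimage_eq inf_commute)
  then obtain k :: "nat \<Rightarrow> nat" where k: "strict_mono k" "?c -` A = range k"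
    using infinite_eq_range_strict_mono by blast
  \<comment> \<open>Pairs are kept or dropped as a whole, so the blocks of \<open>range v\<close>
    are exactly the selected blocks of \<open>w\<close>.\<close>
  define v where "v i = u (2 * k (i div 2) + i mod 2)" for i
  have "strict_mono v"
    unfolding strict_mono_Suc_iff
  proof
    fix i
    have "k (i div 2) < k (Suc (i div 2))"
      using k(1) by (simp add: strict_mono_Suc_iff)
    then have "2 * k (i div 2) + i mod 2 < 2 * k (Suc i div 2) + Suc i mod 2"
      by (cases "even i") (auto elim!: evenE oddE)
    then show "v i < v (Suc i)"
      unfolding v_def using u(1) by (simp add: strict_mono_less)
  qed
  moreover have "a (v (2 * i)) (v (Suc (2 * i))) \<in> A" for i
    using k(2) by (auto simp: v_def)
  ultimately have "range v \<in> homogeneous_sets a \<A>"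
    unfolding homogeneous_sets_def infinite_subsets_def
    using A(1) block_range[of v] by (auto simp: infinite_range_strict_mono)
  moreover have "range v \<in> infinite_subsets w"
    using u(2) infinite_range_strict_mono[OF \<open>strict_mono v\<close>]
    by (auto simp: infinite_subsets_def) (simp add: v_def)
  ultimately show ?thesis by blast
qed

lemma MAD_family_not_all_homogeneous:
  assumes mad: "MAD_family \<A>" and "infinite w"
    and A: "inj A" "range A \<subseteq> \<A>"
    and a: "\<And>i j. j \<le> a i j" "\<And>i j. a i j \<in> A i"
  shows "\<not> infinite_subsets w \<subseteq> homogeneous_sets a \<A>"
proof
  assume hom: "infinite_subsets w \<subseteq> homogeneous_sets a \<A>"
  obtain u :: "nat \<Rightarrow> nat" where u: "strict_mono u" "w = range u"
    using infinite_eq_range_strict_mono[OF \<open>infinite w\<close>] .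
  let ?c = "\<lambda>k. a (u (2 * k)) (u (Suc (2 * k)))"
  have unique: "B = B'" if "B \<in> \<A>" "B' \<in> \<A>" "infinite D" "D \<subseteq> B" "D \<subseteq> B'" for B B' D
    using mad that unfolding MAD_family_def by (meson finite_subset le_inf_iff)
  have "w \<in> homogeneous_sets a \<A>"
    using hom \<open>infinite w\<close> by (auto simp: infinite_subsets_def)
  then obtain B where B: "B \<in> \<A>" "\<And>k. ?c k \<in> B"
    unfolding homogeneous_sets_def u(2) using block_range[OF u(1)] by blast
  have mem: "a m n \<in> B" if "m \<in> w" "n \<in> w" "m < n" for m n
  proof -
    \<comment> \<open>The shift \<open>2 * n\<close> is even, so that blocks of the tail stay blocks
      of \<open>w\<close>, and large enough that the tail starts above \<open>n\<close>.\<close>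
    define v where "v i = (if i = 0 then m else if i = 1 then n else u (2 * n + i))" for i
    have "n < u (2 * n + 2)"
      using strict_mono_imp_increasing[OF u(1), of "2 * n + 2"] by linarith
    then have "strict_mono v"
      using u(1) \<open>m < n\<close> unfolding strict_mono_Suc_iff by (auto simp: v_def numeral_2_eq_2)
    then have "range v \<in> infinite_subsets w"
      using that u(2) infinite_range_strict_mono[of v]
      by (auto simp: infinite_subsets_def) (auto simp: v_def)
    then have "range v \<in> homogeneous_sets a \<A>"
      using hom by blast
    then obtain B' where B': "B' \<in> \<A>" "\<And>k. a (v (2 * k)) (v (Suc (2 * k))) \<in> B'"
      unfolding homogeneous_sets_def using block_range[OF \<open>strict_mono v\<close>] by blast
    \<comment> \<open>Block \<open>k - n\<close> of \<open>range v\<close> is block \<open>k\<close>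
      of \<open>w\<close>; the index \<open>0\<close> is excluded because it belongs to the new pair
      \<open>m\<close>, \<open>n\<close>.\<close>
    have "?c k \<in> B'" if "k > n" for k
    proof -
      have "v (2 * (k - n)) = u (2 * k)" "v (Suc (2 * (k - n))) = u (Suc (2 * k))"
        using that by (auto simp: v_def algebra_simps)
      then show ?thesis using B'(2)[of "k - n"] by simp
    qed
    moreover have "infinite (?c ` {n<..})"
      by (rule infinite_blocks_image[OF u(1) infinite_Ioi]) (rule a(1))
    ultimately have "B' = B"
      using B B'(1) by (intro unique[of _ _ "?c ` {n<..}"]) auto
    then show ?thesis
      using B'(2)[of 0] by (simp add: v_def)
  qed
  \<comment> \<open>With \<open>m\<close> fixed, the points \<open>a m n\<close> for larger
    \<open>n\<close> in \<open>w\<close> form an infinite subset of both \<open>B\<close> and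
    \<open>A m\<close>.\<close>
  have "B = A m" if "m \<in> w" for m
  proof (rule unique)
    show "infinite (a m ` (w \<inter> {m<..}))"
      unfolding infinite_nat_iff_unbounded_le
    proof
      fix k
      obtain n where "n \<in> w" "max k (Suc m) \<le> n"
        using \<open>infinite w\<close> unfolding infinite_nat_iff_unbounded_le by blast
      then show "\<exists>i\<ge>k. i \<in> a m ` (w \<inter> {m<..})"
        using a(1)[of n m] by (intro exI[of _ "a m n"]) auto
    qed
  qed (use that A B a mem in auto)
  then have "A (u 0) = A (u 1)"
    using u(2) by blast
  then show False
    using A(1) u(1) by (simp add: inj_eq strict_mono_eq)
qed

theorem theorem1:
  fixes \<Gamma> :: "nat set topology \<Rightarrow> nat set set set"
  assumes "good_pointclass \<Gamma>"
    and "\<forall>X \<in> \<Gamma> infinite_subsets_space. Ramsey_property X"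
  shows "\<not> (\<exists>\<A> \<in> \<Gamma> infinite_subsets_space. MAD_family \<A>)"
proof
  assume "\<exists>\<A> \<in> \<Gamma> infinite_subsets_space. MAD_family \<A>"
  then obtain \<A> where \<A>: "\<A> \<in> \<Gamma> infinite_subsets_space" and mad: "MAD_family \<A>"
    by blast
  obtain A :: "nat \<Rightarrow> nat set" where A: "inj A" "range A \<subseteq> \<A>"
    using mad unfolding MAD_family_def by (meson infinite_countable_subset)
  \<comment> \<open>Increasing enumeration provides \<open>j \<le> a i j\<close>, on which all the
    infinitude arguments rest.\<close>
  define a where "a i = enumerate (A i)" for i
  have inf: "infinite (A i)" for i
  proof -
    have "\<A> \<subseteq> infinite_subsets UNIV"
      using mad by (simp add: MAD_family_def)
    then show ?thesis using A(2) by (auto simp: infinite_subsets_def)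
  qed
  have a: "j \<le> a i j" "a i j \<in> A i" for i j
    unfolding a_def using inf[of i] by (simp_all add: le_enumerate enumerate_in_set)
  have "Ramsey_property (homogeneous_sets a \<A>)"
    using assms homogeneous_sets_in_pointclass[OF assms(1) \<A>] by blast
  then obtain w where w: "infinite w"
    "infinite_subsets w \<subseteq> homogeneous_sets a \<A> \<or> infinite_subsets w \<inter> homogeneous_sets a \<A> = {}"
    unfolding Ramsey_property_def infinite_subsets_def[of UNIV] by blast
  then show False
    using MAD_family_meets_homogeneous_sets[of \<A> w a] MAD_family_not_all_homogeneous[of \<A> w A a]
      mad A a by blast
qed

end
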